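(* For every $0<\epsilon\le 1$ there is a (randomized) $O(1/\epsilon)$-round algorithm in the CONGEST model that, on every unweighted graph with $n$ nodes and maximum degree $\Delta\le n/\log n$, finds, with high probability, an independent set of size at least $\frac{n}{(1+\epsilon)(\Delta+1)}$.
   Context: CONGEST model: the input graph is a synchronous communication network of $n$ computationally unbounded nodes, each with a unique $O(\log n)$-bit identifier; in each round each node may send a message of $O(\log n)$ bits to each of its neighbors. Initially a node knows only its own identifier and some polynomial upper bound on $n$ (it does not know $n$ or $\Delta$); at the end each node must know whether it belongs to the output set. Complexity is the number of rounds. Randomized algorithms: each node has private random bits. "With high probability" means with probability at least $1-1/n^c$ for an arbitrary constant $c>1$. $\log$ is to base 2. *)

theory Defs
  imports "HOL-Probability.Probability" "HOL-Library.Ramsey"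
begin

(* A node is identified with its unique identifier, so nodes are natural numbers. Edges are
   two-element sets. "ports G v" lists the neighbours of v in an arbitrary order; a node
   addresses its links by position in this list and does not see the list itself.
   "size_bound G" is the upper bound on the number of nodes that every node is given. *)
record network =
  nodes :: "nat set"
  edges :: "nat set set"
  ports :: "nat \<Rightarrow> nat list"
  size_bound :: nat

definition neighbours :: "network \<Rightarrow> nat \<Rightarrow> nat set" where
  "neighbours G v = {u. {u, v} \<in> edges G}"

definition degree :: "network \<Rightarrow> nat \<Rightarrow> nat" where
  "degree G v = card (neighbours G v)"

definition max_degree :: "network \<Rightarrow> nat" where
  "max_degree G = Max (degree G ` nodes G)"

(* The constant k bounds both the identifiers, which have O(log n) bits exactly if they are
   polynomially bounded, and the known upper bound on n. Every polynomial in n \<ge> 1 is below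
   k * n ^ k for some k. *)
definition valid_network :: "nat \<Rightarrow> network \<Rightarrow> bool" where
  "valid_network k G \<longleftrightarrow>
     finite (nodes G) \<and> nodes G \<noteq> {} \<and> edges G \<subseteq> nsets (nodes G) 2 \<and>
     (\<forall>v\<in>nodes G. distinct (ports G v) \<and> set (ports G v) = neighbours G v) \<and>
     (\<forall>v\<in>nodes G. v < k * card (nodes G) ^ k) \<and>
     card (nodes G) \<le> size_bound G \<and> size_bound G \<le> k * card (nodes G) ^ k"

(* Everything a node knows at the end of a round. The list "received" has one entry per
   completed round, namely the list of the messages received in that round, by port.
   In particular, a node does not know its degree before the first round.
   The private random bits form an infinite tape. *)
record view =
  own_id :: nat
  bound :: nat
  coins :: "nat \<Rightarrow> bool"
  received :: "bool list list list"

(* As nodes are computationally unbounded, a node keeps its whole view, and an algorithm is a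
   pair of arbitrary functions of the view: the message sent through each port in the next
   round (the empty string stands for sending nothing), and the decision whether the node
   belongs to the output set (None as long as it is undecided). *)
record congest_algorithm =
  message :: "view \<Rightarrow> nat \<Rightarrow> bool list"
  decision :: "view \<Rightarrow> bool option"

definition port_to :: "network \<Rightarrow> nat \<Rightarrow> nat \<Rightarrow> nat" where
  "port_to G u v = (THE i. i < length (ports G u) \<and> ports G u ! i = v)"

(* "w v" is the random tape of node v. *)
primrec view_after ::
  "congest_algorithm \<Rightarrow> network \<Rightarrow> (nat \<Rightarrow> nat \<Rightarrow> bool) \<Rightarrow> nat \<Rightarrow> nat \<Rightarrow> view" where
  "view_after A G w 0 v =
     \<lparr>own_id = v, bound = size_bound G, coins = w v, received = []\<rparr>"
| "view_after A G w (Suc t) v =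
     \<lparr>own_id = v, bound = size_bound G, coins = w v,
      received = received (view_after A G w t v) @
        [map (\<lambda>u. message A (view_after A G w t u) (port_to G u v)) (ports G v)]\<rparr>"

definition bandwidth_le :: "congest_algorithm \<Rightarrow> network \<Rightarrow> real \<Rightarrow> bool" where
  "bandwidth_le A G L \<longleftrightarrow>
     (\<forall>w t. \<forall>v\<in>nodes G. \<forall>i<degree G v. real (length (message A (view_after A G w t v) i)) \<le> L)"

definition rounds_le :: "congest_algorithm \<Rightarrow> network \<Rightarrow> real \<Rightarrow> bool" where
  "rounds_le A G R \<longleftrightarrow>
     (\<forall>w. \<forall>v\<in>nodes G. \<exists>t. real t \<le> R \<and> decision A (view_after A G w t v) \<noteq> None)"

(* The first decision of a node is binding. *)
definition output_set ::
  "congest_algorithm \<Rightarrow> network \<Rightarrow> (nat \<Rightarrow> nat \<Rightarrow> bool) \<Rightarrow> nat set" where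
  "output_set A G w =
     {v \<in> nodes G. \<exists>t. decision A (view_after A G w t v) = Some True \<and>
        (\<forall>s<t. decision A (view_after A G w s v) = None)}"

(* Independent fair coins, for all nodes and all tape positions. *)
definition coin_space :: "network \<Rightarrow> (nat \<Rightarrow> nat \<Rightarrow> bool) measure" where
  "coin_space G =
     PiM (nodes G) (\<lambda>_. PiM (UNIV :: nat set) (\<lambda>_. measure_pmf (bernoulli_pmf (1/2))))"

end

theory Submission
  imports Defs
begin

text \<open>In each phase every undecided node tosses a block of coins, and joins if the number of heads at
  the start of its block exceeds that of all its undecided neighbours; then its neighbours drop
  out. Fix \<open>p = 2\<^sup>-\<^sup>j\<close> of order \<open>1 / (\<Delta> + 1)\<close> and call a node marked if its block starts with \<open>j\<close> heads: a marked
  node without marked undecided neighbours joins, so the nodes need not know \<open>\<Delta>\<close>. If \<open>X\<close> is the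
  number of these nodes and \<open>U\<close> the set of undecided nodes, then
  \<open>E ((1/2)\<^sup>X) \<le> (1 - p/4)\<^bsup>|U|\<^esup>\<close>. As long as the set \<open>I\<close> of chosen nodes is too small, at least \<open>\<epsilon> n / 2\<close>
  nodes are undecided, so the expectation of \<open>(1/2)\<^bsup>|I|\<^esup>\<close> on this event decreases by the factor
  \<open>exp (- \<Omega> (\<epsilon> n / (\<Delta> + 1)))\<close> per phase. After \<open>O(1/\<epsilon>)\<close> phases this outweighs the factor
  \<open>2\<^bsup>n / (\<Delta> + 1)\<^esup>\<close> lost to Markov's inequality, and \<open>n / (\<Delta> + 1) \<ge> (log n) / 2\<close>.\<close>

section \<open>Expectations over random subsets\<close>

text \<open>Expectation of \<open>h\<close> at a random subset of \<open>A\<close> that contains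
  each element independently with probability \<open>p\<close>. As a finite sum it keeps the
  probabilistic argument free of measurability; the link to \<open>coin_space\<close> is
  \<open>prob_coin_space_finite\<close>.\<close>

definition subset_mean :: "real \<Rightarrow> 'a set \<Rightarrow> ('a set \<Rightarrow> real) \<Rightarrow> real" where
  "subset_mean p A h = (\<Sum>S\<in>Pow A. p ^ card S * (1 - p) ^ card (A - S) * h S)"

lemma subset_mean_empty [simp]: "subset_mean p {} h = h {}"
  by (simp add: subset_mean_def)

lemma subset_mean_cong:
  "(\<And>S. S \<subseteq> A \<Longrightarrow> h S = g S) \<Longrightarrow> subset_mean p A h = subset_mean p A g"
  unfolding subset_mean_def by (rule sum.cong) auto

lemma subset_mean_mono:
  assumes "0 \<le> p" "p \<le> 1" "\<And>S. S \<subseteq> A \<Longrightarrow> h S \<le> g S"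
  shows "subset_mean p A h \<le> subset_mean p A g"
  unfolding subset_mean_def using assms by (intro sum_mono mult_left_mono) auto

lemma subset_mean_cmult: "subset_mean p A (\<lambda>S. c * h S) = c * subset_mean p A h"
  by (simp add: subset_mean_def sum_distrib_left algebra_simps)

lemma subset_mean_add: "subset_mean p A (\<lambda>S. h S + g S) = subset_mean p A h + subset_mean p A g"
  by (simp add: subset_mean_def sum.distrib algebra_simps)

text \<open>Conditioning on whether \<open>x\<close> is drawn. This recursion drives the inductions
  on \<open>A\<close>.\<close>

lemma subset_mean_insert:
  assumes "finite A" "x \<notin> A"
  shows "subset_mean p (insert x A) h =
    (1 - p) * subset_mean p A h + p * subset_mean p A (\<lambda>S. h (insert x S))"
proof -
  have inj: "inj_on (insert x) (Pow A)"
    using assms(2) by (auto simp: inj_on_def)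
  have split: "subset_mean p (insert x A) h =
      (\<Sum>S\<in>Pow A. p ^ card S * (1 - p) ^ card (insert x A - S) * h S) +
      (\<Sum>S\<in>Pow A. p ^ card (insert x S) * (1 - p) ^ card (insert x A - insert x S) * h (insert x S))"
    unfolding subset_mean_def Pow_insert
    by (subst sum.union_disjoint) (use assms inj in \<open>auto simp: sum.reindex\<close>)
  have cards: "card (insert x A - S) = Suc (card (A - S))" "card (insert x S) = Suc (card S)"
    "insert x A - insert x S = A - S" if "S \<subseteq> A" for S
  proof -
    have "finite S" "x \<notin> S" "insert x A - S = insert x (A - S)"
      using that assms finite_subset by auto
    then show "card (insert x A - S) = Suc (card (A - S))" "card (insert x S) = Suc (card S)"
      using assms by simp_all
    show "insert x A - insert x S = A - S"
      using assms by auto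
  qed
  have "(\<Sum>S\<in>Pow A. p ^ card S * (1 - p) ^ card (insert x A - S) * h S) = (1 - p) * subset_mean p A h"
    unfolding subset_mean_def sum_distrib_left by (rule sum.cong) (simp_all add: cards(1))
  moreover have
    "(\<Sum>S\<in>Pow A. p ^ card (insert x S) * (1 - p) ^ card (insert x A - insert x S) * h (insert x S))
      = p * subset_mean p A (\<lambda>S. h (insert x S))"
    unfolding subset_mean_def sum_distrib_left
    by (rule sum.cong) (simp_all add: cards(2,3) del: insert_Diff1 Diff_insert)
  ultimately show ?thesis
    unfolding split by simp
qed

lemma subset_mean_const [simp]: "finite A \<Longrightarrow> subset_mean p A (\<lambda>_. c) = c"
  by (induction A rule: finite_induct) (simp_all add: subset_mean_insert algebra_simps)

text \<open>Fubini: the draws on disjoint sets are independent. It separates the coins of different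
  nodes and phases.\<close>

lemma subset_mean_Un:
  assumes "finite A" "finite B" "A \<inter> B = {}"
  shows "subset_mean p (A \<union> B) h = subset_mean p A (\<lambda>S. subset_mean p B (\<lambda>R. h (S \<union> R)))"
  using assms(1,3)
proof (induction A arbitrary: h rule: finite_induct)
  case (insert x A)
  then have "x \<notin> A \<union> B" "A \<inter> B = {}" by auto
  with insert assms(2) show ?case by (simp add: subset_mean_insert)
qed simp

text \<open>The case of a block of coins that matters only through whether all of them show heads.
  Subtracting \<open>b\<close> leaves a function supported at \<open>S = A\<close>, so a single
  summand survives.\<close>

lemma subset_mean_full:
  assumes "finite A"
  shows "subset_mean p A (\<lambda>S. if S = A then a else b) = p ^ card A * a + (1 - p ^ card A) * b"
proof -
  have "subset_mean p A (\<lambda>S. if S = A then a - b else 0) =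
      (\<Sum>S\<in>Pow A. if A = S then p ^ card A * (a - b) else 0)"
    unfolding subset_mean_def by (intro sum.cong) auto
  also have "\<dots> = p ^ card A * (a - b)"
    using assms by simp
  finally have "subset_mean p A (\<lambda>S. b + (if S = A then a - b else 0)) = b + p ^ card A * (a - b)"
    using assms by (simp add: subset_mean_add)
  moreover have "(\<lambda>S. b + (if S = A then a - b else 0)) = (\<lambda>S. if S = A then a else b)"
    by auto
  ultimately show ?thesis by (simp add: algebra_simps)
qed

text \<open>Here \<open>J\<close> is a block of coin positions, and a node is marked if all its
  coins in the block are heads. The blocks are disjoint, so the marks are again independent, with
  probability \<open>p ^ card J\<close>.\<close>

lemma subset_mean_Times:
  assumes "finite V" "finite J"
  shows "subset_mean p (V \<times> J) (\<lambda>S. h {v \<in> V. {v} \<times> J \<subseteq> S}) = subset_mean (p ^ card J) V h"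
  using assms(1)
proof (induction V arbitrary: h rule: finite_induct)
  case (insert x F)
  let ?q = "p ^ card J"
  let ?a = "subset_mean p (F \<times> J) (\<lambda>R. h (insert x {v \<in> F. {v} \<times> J \<subseteq> R}))"
  let ?b = "subset_mean p (F \<times> J) (\<lambda>R. h {v \<in> F. {v} \<times> J \<subseteq> R})"
  have un: "insert x F \<times> J = {x} \<times> J \<union> F \<times> J" and disj: "({x} \<times> J) \<inter> (F \<times> J) = {}"
    using insert.hyps by auto
  have marks: "{v \<in> insert x F. {v} \<times> J \<subseteq> S \<union> R} =
      (if S = {x} \<times> J then insert x {v \<in> F. {v} \<times> J \<subseteq> R} else {v \<in> F. {v} \<times> J \<subseteq> R})"
    if "S \<subseteq> {x} \<times> J" "R \<subseteq> F \<times> J" for S R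
  proof -
    have "{v} \<times> J \<subseteq> S \<union> R \<longleftrightarrow> {v} \<times> J \<subseteq> R" if "v \<in> F" for v
      using \<open>S \<subseteq> _\<close> \<open>v \<in> F\<close> insert.hyps by auto
    moreover have "{x} \<times> J \<subseteq> S \<union> R \<longleftrightarrow> S = {x} \<times> J"
      using that insert.hyps by blast
    ultimately show ?thesis by auto
  qed
  have "subset_mean p (insert x F \<times> J) (\<lambda>S. h {v \<in> insert x F. {v} \<times> J \<subseteq> S}) =
      subset_mean p ({x} \<times> J) (\<lambda>S. subset_mean p (F \<times> J) (\<lambda>R. h {v \<in> insert x F. {v} \<times> J \<subseteq> S \<union> R}))"
    unfolding un using disj insert.hyps assms by (intro subset_mean_Un) auto
  also have "\<dots> = subset_mean p ({x} \<times> J) (\<lambda>S. if S = {x} \<times> J then ?a else ?b)"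
  proof (rule subset_mean_cong)
    fix S assume S: "S \<subseteq> {x} \<times> J"
    show "subset_mean p (F \<times> J) (\<lambda>R. h {v \<in> insert x F. {v} \<times> J \<subseteq> S \<union> R}) =
        (if S = {x} \<times> J then ?a else ?b)"
    proof (cases "S = {x} \<times> J")
      case True
      have "subset_mean p (F \<times> J) (\<lambda>R. h {v \<in> insert x F. {v} \<times> J \<subseteq> S \<union> R}) = ?a"
      proof (rule subset_mean_cong)
        fix R assume "R \<subseteq> F \<times> J"
        show "h {v \<in> insert x F. {v} \<times> J \<subseteq> S \<union> R} = h (insert x {v \<in> F. {v} \<times> J \<subseteq> R})"
          unfolding marks[OF S \<open>R \<subseteq> F \<times> J\<close>] using True by (simp only: if_True refl)
      qed
      then show ?thesis using True by (simp only: if_True refl)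
    next
      case False
      have "subset_mean p (F \<times> J) (\<lambda>R. h {v \<in> insert x F. {v} \<times> J \<subseteq> S \<union> R}) = ?b"
      proof (rule subset_mean_cong)
        fix R assume "R \<subseteq> F \<times> J"
        show "h {v \<in> insert x F. {v} \<times> J \<subseteq> S \<union> R} = h {v \<in> F. {v} \<times> J \<subseteq> R}"
          unfolding marks[OF S \<open>R \<subseteq> F \<times> J\<close>] using False by (simp only: if_False refl)
      qed
      then show ?thesis using False by (simp only: if_False refl)
    qed
  qed
  also have "\<dots> = ?q * ?a + (1 - ?q) * ?b"
    using subset_mean_full[of "{x} \<times> J" p ?a ?b] assms by (simp add: card_cartesian_product)
  also have "?a = subset_mean ?q F (\<lambda>M. h (insert x M))"
    by (rule insert.IH[of "\<lambda>M. h (insert x M)"])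
  also have "?b = subset_mean ?q F h"
    by (rule insert.IH[of h])
  also have "?q * subset_mean ?q F (\<lambda>M. h (insert x M)) + (1 - ?q) * subset_mean ?q F h
      = subset_mean ?q (insert x F) h"
    by (simp only: subset_mean_insert[OF insert.hyps])
  finally show ?case .
next
  case empty
  show ?case unfolding Sigma_empty1 subset_mean_empty by simp
qed

section \<open>Isolated vertices in a random vertex set\<close>

text \<open>The vertices are explored in the order given by \<open>k\<close>, where \<open>B\<close> is the set of vertices blocked
  by neighbours explored before. A marked vertex contributes \<open>2\<close> if it is blocked and \<open>1/2\<close> if not, and
  blocks at most \<open>D\<close> others, which costs a factor of at most \<open>(1 + 5p/2)\<^sup>D \<le> 3/2\<close>.\<close>

lemma subset_mean_ordered:
  fixes k :: "nat \<Rightarrow> int" and p :: real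
  assumes "finite A" "0 \<le> p" "8 * p * (real D + 1) \<le> 1"
    and "\<And>v. v \<in> A \<Longrightarrow> card (N v \<inter> A) \<le> D"
  shows "subset_mean p A (\<lambda>M. \<Prod>x\<in>M. if x \<in> B \<or> (\<exists>y\<in>M. k y < k x \<and> x \<in> N y) then 2 else 1/2)
    \<le> (\<Prod>x\<in>A. if x \<in> B then 1 + 2 * p else 1 - p / 4)"
  using assms(1,4)
proof (induction A arbitrary: B rule: finite_psubset_induct)
  case (psubset A)
  show ?case
  proof (cases "A = {}")
    case False
    have p: "p \<le> 1/8"
    proof -
      have "8 * p * 1 \<le> 8 * p * (real D + 1)"
        using assms(2) by (intro mult_left_mono) auto
      then show ?thesis using assms(3) by linarith
    qed
    \<comment> \<open>The vertex explored first: nothing in \<open>A\<close> strictly precedes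
      it.\<close>
    obtain x where x: "x \<in> A" "\<And>y. y \<in> A \<Longrightarrow> k x \<le> k y"
    proof -
      have "Min (k ` A) \<in> k ` A" using False psubset.hyps by simp
      then obtain x where "x \<in> A" "k x = Min (k ` A)" by auto
      then show ?thesis using that psubset.hyps by simp
    qed
    define A' where "A' = A - {x}"
    have A: "A = insert x A'" "x \<notin> A'" "finite A'" "A' \<subset> A"
      using x psubset.hyps by (auto simp: A'_def)
    let ?f = "\<lambda>B M. \<Prod>x\<in>M. if x \<in> B \<or> (\<exists>y\<in>M. k y < k x \<and> x \<in> N y) then 2 else 1/2 :: real"
    let ?g = "\<lambda>B. \<Prod>x\<in>A'. if x \<in> B then 1 + 2 * p else 1 - p / 4"
    let ?c = "if x \<in> B then 2 else 1/2 :: real"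
    define B' where "B' = B \<union> {z \<in> N x. k x < k z}"
    have IH: "subset_mean p A' (?f B) \<le> ?g B" for B
    proof (rule psubset.IH[OF A(4)])
      fix v assume "v \<in> A'"
      have "card (N v \<inter> A') \<le> card (N v \<inter> A)"
        using psubset.hyps A(4) by (intro card_mono) auto
      also have "\<dots> \<le> D" using \<open>v \<in> A'\<close> A by (intro psubset.prems) auto
      finally show "card (N v \<inter> A') \<le> D" .
    qed
    \<comment> \<open>Only \<open>B\<close> can block the first vertex \<open>x\<close>. For the
      others, the presence of \<open>x\<close> amounts to blocking its later neighbours as well,
      that is, to replacing \<open>B\<close> by \<open>B'\<close>.\<close>
    have ins: "?f B (insert x M) = ?c * ?f B' M" if "M \<subseteq> A'" for M
    proof -
      have M: "finite M" "x \<notin> M" using that A finite_subset by auto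
      have "\<not> k y < k x" if "y \<in> insert x M" for y
        using x(2)[of y] that \<open>M \<subseteq> A'\<close> A(1) by auto
      then have "(x \<in> B \<or> (\<exists>y\<in>insert x M. k y < k x \<and> x \<in> N y)) \<longleftrightarrow> x \<in> B"
        by blast
      moreover have "(z \<in> B \<or> (\<exists>y\<in>insert x M. k y < k z \<and> z \<in> N y)) \<longleftrightarrow>
          (z \<in> B' \<or> (\<exists>y\<in>M. k y < k z \<and> z \<in> N y))" for z
        by (auto simp: B'_def)
      ultimately show ?thesis
        unfolding prod.insert[OF M] by (simp only:)
    qed
    have g0: "0 \<le> ?g B" using assms(2) p by (intro prod_nonneg) auto
    \<comment> \<open>Passing from \<open>B\<close> to \<open>B'\<close> can only turn a factor
      \<open>1 - p / 4\<close> into \<open>1 + 2 * p\<close>, at neighbours of \<open>x\<close>. The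
      ratio is at most \<open>1 + 5/2 * p\<close>, since \<open>p \<le> 1/8\<close>.\<close>
    have "(if z \<in> B' then 1 + 2 * p else 1 - p / 4) \<le>
        (if z \<in> B then 1 + 2 * p else 1 - p / 4) * (if z \<in> N x then 1 + 5/2 * p else 1)" for z
    proof -
      have "p * p \<le> p * (1/8)" using p assms(2) by (intro mult_left_mono) auto
      then have "1 + 2 * p \<le> (1 - p / 4) * (1 + 5/2 * p)"
        by (simp add: algebra_simps) (use assms(2) in linarith)
      moreover have "1 + 2 * p \<le> (1 + 2 * p) * (1 + 5/2 * p)"
        "1 - p / 4 \<le> (1 - p / 4) * (1 + 5/2 * p)"
        using assms(2) p by (simp_all add: mult_le_cancel_left1)
      ultimately show ?thesis using assms(2) by (auto simp: B'_def)
    qed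
    then have "?g B' \<le> (\<Prod>z\<in>A'. (if z \<in> B then 1 + 2 * p else 1 - p / 4) * (if z \<in> N x then 1 + 5/2 * p else 1))"
      using assms(2) p by (intro prod_mono) auto
    also have "\<dots> = ?g B * (1 + 5/2 * p) ^ card (N x \<inter> A')"
      using A(3) by (simp add: prod.distrib prod.If_cases Int_commute)
    also have "\<dots> \<le> ?g B * (3/2)"
    proof (rule mult_left_mono[OF _ g0])
      have "card (N x \<inter> A') \<le> card (N x \<inter> A)"
        using psubset.hyps A(4) by (intro card_mono) auto
      also have "\<dots> \<le> D" using x by (intro psubset.prems) auto
      finally have "(1 + 5/2 * p) ^ card (N x \<inter> A') \<le> (1 + 5/2 * p) ^ D"
        using assms(2) by (intro power_increasing) auto
      also have "\<dots> \<le> exp (5/2 * p) ^ D"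
        using assms(2) by (intro power_mono) auto
      also have "\<dots> = exp (5/2 * p * D)"
        by (simp add: exp_of_nat_mult[symmetric] mult.commute)
      \<comment> \<open>\<open>8 * p * D \<le> 1\<close> gives
        \<open>5/2 * p * D \<le> 5/16\<close>.\<close>
      also have "\<dots> \<le> exp (5/16)"
        using assms(2,3) by (simp add: algebra_simps)
      also have "\<dots> \<le> 3/2"
        using exp_bound[of "5/16"] by (simp add: power2_eq_square)
      finally show "(1 + 5/2 * p) ^ card (N x \<inter> A') \<le> 3/2" .
    qed
    finally have g': "?g B' \<le> 3/2 * ?g B" by simp
    have "subset_mean p A (?f B) =
        (1 - p) * subset_mean p A' (?f B) + p * subset_mean p A' (\<lambda>M. ?f B (insert x M))"
      unfolding A(1) by (rule subset_mean_insert) (use A in auto)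
    also have "subset_mean p A' (\<lambda>M. ?f B (insert x M)) = ?c * subset_mean p A' (?f B')"
      unfolding subset_mean_cmult[symmetric] by (rule subset_mean_cong) (rule ins)
    also have "(1 - p) * subset_mean p A' (?f B) + p * (?c * subset_mean p A' (?f B'))
        \<le> (1 - p) * ?g B + p * (?c * (3/2 * ?g B))"
      using assms(2) p IH[of B] order_trans[OF IH[of B'] g']
      by (intro add_mono mult_left_mono) auto
    \<comment> \<open>The weights are chosen to reproduce themselves:
      \<open>(1 - p) + p * 2 * (3/2) = 1 + 2 * p\<close> for a blocked \<open>x\<close>, and
      \<open>(1 - p) + p * (1/2) * (3/2) = 1 - p / 4\<close> otherwise.\<close>
    also have "\<dots> = (if x \<in> B then 1 + 2 * p else 1 - p / 4) * ?g B"
      by (simp add: algebra_simps)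
    also have "\<dots> = (\<Prod>x\<in>A. if x \<in> B then 1 + 2 * p else 1 - p / 4)"
      using A by simp
    finally show ?thesis .
  qed simp
qed

text \<open>A marked vertex is isolated iff it is blocked neither in the order of the vertices nor in the
  reverse order. Hence \<open>(1/4)\<^sup>X\<close>, with \<open>X\<close> isolated marked vertices, is at most the product of the
  weights of \<open>subset_mean_ordered\<close> for the two orders, which AM-GM separates.\<close>

lemma subset_mean_isolated:
  fixes p :: real and N :: "nat \<Rightarrow> nat set"
  assumes "finite A" "0 \<le> p" "8 * p * (real D + 1) \<le> 1"
    and "\<And>v. v \<in> A \<Longrightarrow> card (N v \<inter> A) \<le> D"
    and sym: "\<And>u v. u \<in> N v \<longleftrightarrow> v \<in> N u" and irrefl: "\<And>v. v \<notin> N v"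
  shows "subset_mean p A (\<lambda>M. (1/2) ^ card {v \<in> M. N v \<inter> M = {}}) \<le> (1 - p / 4) ^ card A"
proof -
  let ?f = "\<lambda>k M. \<Prod>x\<in>M. if x \<in> {} \<or> (\<exists>y\<in>M. k y < k x \<and> x \<in> N y) then 2 else 1/2 :: real"
  have ordered: "subset_mean p A (?f k) \<le> (1 - p / 4) ^ card A" for k :: "nat \<Rightarrow> int"
    using subset_mean_ordered[OF assms(1-4), where B = "{}" and k = k] by simp
  have "(1/2) ^ card {v \<in> M. N v \<inter> M = {}} \<le> (1/2) * ?f int M + (1/2) * ?f (\<lambda>x. - int x) M"
    if "M \<subseteq> A" for M
  proof -
    have M: "finite M" using that assms(1) finite_subset by auto
    let ?X = "(1/2 :: real) ^ card {v \<in> M. N v \<inter> M = {}}"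
    let ?a = "?f int M" and ?b = "?f (\<lambda>x. - int x) M"
    have "?X\<^sup>2 = (1/4) ^ card {v \<in> M. N v \<inter> M = {}}"
      by (simp add: power2_eq_square flip: power_mult_distrib)
    also have "\<dots> = (\<Prod>x\<in>M. if N x \<inter> M = {} then 1/4 else 1)"
      using M by (simp add: prod.If_cases Int_def)
    also have "\<dots> \<le> (\<Prod>x\<in>M. (if x \<in> {} \<or> (\<exists>y\<in>M. int y < int x \<and> x \<in> N y) then 2 else 1/2) *
        (if x \<in> {} \<or> (\<exists>y\<in>M. - int y < - int x \<and> x \<in> N y) then 2 else 1/2))"
    proof (intro prod_mono conjI)
      fix x assume "x \<in> M"
      show "(if N x \<inter> M = {} then 1/4 else 1) \<le>
        (if x \<in> {} \<or> (\<exists>y\<in>M. int y < int x \<and> x \<in> N y) then 2 else 1/2) *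
        (if x \<in> {} \<or> (\<exists>y\<in>M. - int y < - int x \<and> x \<in> N y) then 2 else 1/2 :: real)"
      \<comment> \<open>If \<open>x\<close> is isolated, both factors are \<open>1/2\<close>.
        Otherwise a marked neighbour precedes \<open>x\<close> in one of the two orders, so one
        factor is 2 and the product is at least 1.\<close>
      proof (cases "N x \<inter> M = {}")
        case False
        then obtain y where "y \<in> M" "x \<in> N y" "y \<noteq> x"
          using sym irrefl by blast
        then have "(\<exists>y\<in>M. int y < int x \<and> x \<in> N y) \<or> (\<exists>y\<in>M. - int y < - int x \<and> x \<in> N y)"
          by (metis linorder_neqE_nat neg_less_iff_less of_nat_less_iff)
        then show ?thesis by auto
      qed auto
    qed auto
    also have "\<dots> = ?a * ?b"
      by (rule prod.distrib)
    finally have le: "?X\<^sup>2 \<le> ?a * ?b" .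
    have nonneg: "0 \<le> ?a" "0 \<le> ?b" by (auto intro!: prod_nonneg)
    have "?X = sqrt (?X\<^sup>2)" by simp
    also have "\<dots> \<le> sqrt (?a * ?b)" using le by (rule real_sqrt_le_mono)
    also have "\<dots> \<le> (?a + ?b) / 2" using nonneg by (rule arith_geo_mean_sqrt)
    finally show ?thesis by simp
  qed
  moreover have "p \<le> 1"
  proof -
    have "8 * p * 1 \<le> 8 * p * (real D + 1)"
      using assms(2) by (intro mult_left_mono) auto
    then show ?thesis using assms(2,3) by linarith
  qed
  ultimately have "subset_mean p A (\<lambda>M. (1/2) ^ card {v \<in> M. N v \<inter> M = {}})
      \<le> subset_mean p A (\<lambda>M. (1/2) * ?f int M + (1/2) * ?f (\<lambda>x. - int x) M)"
    using assms(2) by (intro subset_mean_mono) auto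
  also have "\<dots> = (1/2) * subset_mean p A (?f int) + (1/2) * subset_mean p A (?f (\<lambda>x. - int x))"
    by (simp only: subset_mean_add subset_mean_cmult)
  also have "\<dots> \<le> (1 - p / 4) ^ card A"
    using ordered[of int] ordered[of "\<lambda>x. - int x"] by linarith
  finally show ?thesis .
qed

section \<open>From the coin space to finite means\<close>

lemma coin_space_prob_space: "prob_space (coin_space G)"
  unfolding coin_space_def by (intro prob_space_PiM measure_pmf.prob_space_axioms)

text \<open>The event prescribes the first \<open>L\<close> coins of every node by the pattern
  \<open>S\<close>. It is a product over the nodes of cylinders on the tapes, so its measure factors
  at both levels of the nested product.\<close>

lemma coin_space_cylinder:
  fixes L :: nat and S :: "(nat \<times> nat) set"
  assumes "finite (nodes G)"
  defines "C \<equiv> {w \<in> space (coin_space G). \<forall>v\<in>nodes G. \<forall>i<L. w v i \<longleftrightarrow> (v, i) \<in> S}"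
  shows "C \<in> sets (coin_space G)"
    and "measure (coin_space G) C = (1/2) ^ (card (nodes G) * L)"
proof -
  let ?b = "measure_pmf (bernoulli_pmf (1/2))"
  let ?T = "PiM (UNIV :: nat set) (\<lambda>_. ?b)"
  let ?Y = "\<lambda>v. Pi\<^sub>E {..<L} (\<lambda>i. {(v, i) \<in> S})"
  define X where "X v = prod_emb UNIV (\<lambda>_. ?b) {..<L} (?Y v)" for v
  interpret T: product_prob_space "\<lambda>_. ?b" "UNIV :: nat set"
    by (intro product_prob_spaceI measure_pmf.prob_space_axioms)
  interpret V: product_prob_space "\<lambda>_. ?T" "nodes G"
    by (rule product_prob_spaceI, rule prob_space_PiM, rule measure_pmf.prob_space_axioms)
  have X: "X v = {r. \<forall>i<L. r i \<longleftrightarrow> (v, i) \<in> S}" for v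
    unfolding X_def prod_emb_def
    by (rule set_eqI) (simp add: space_PiM PiE_iff Ball_def)
  have sets_X: "X v \<in> sets ?T" for v
    unfolding X_def by (intro sets_PiM_I) auto
  have C: "C = Pi\<^sub>E (nodes G) X"
    unfolding C_def coin_space_def X by (rule set_eqI) (simp add: space_PiM PiE_iff Ball_def conj_commute)
  show "C \<in> sets (coin_space G)"
    unfolding C coin_space_def using assms(1) sets_X by (intro sets_PiM_I_finite) auto
  have prob_X: "measure ?T (X v) = (1/2) ^ L" for v
  proof -
    have half: "measure ?b {x} = 1/2" for x
      by (cases x) (simp_all add: measure_pmf_single)
    have "measure ?T (X v) = (\<Prod>i<L. measure ?b {(v, i) \<in> S})"
      unfolding X_def by (rule T.measure_PiM_emb) auto
    then show ?thesis by (simp add: half)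
  qed
  \<comment> \<open>The cylinder fixes all coordinates of the outer product, so the embedding is the
    set itself and the product formula for embedded sets applies.\<close>
  have "C = prod_emb (nodes G) (\<lambda>_. ?T) (nodes G) (Pi\<^sub>E (nodes G) X)"
    unfolding C using sets_X by (simp add: prod_emb_PiE_same_index sets.sets_into_space)
  then have "measure (coin_space G) C = (\<Prod>v\<in>nodes G. measure ?T (X v))"
    unfolding coin_space_def using assms(1) sets_X by (subst V.measure_PiM_emb[symmetric]) auto
  then show "measure (coin_space G) C = (1/2) ^ (card (nodes G) * L)"
    by (simp add: prob_X power_mult mult.commute[of "card (nodes G)"])
qed

text \<open>An event that depends on finitely many coins is a disjoint union of equally likely
  cylinders, one for each pattern \<open>S\<close> that satisfies it.\<close>

lemma prob_coin_space_finite: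
  fixes L :: nat
  assumes "finite (nodes G)"
    and local: "\<And>w w'. (\<And>v i. v \<in> nodes G \<Longrightarrow> i < L \<Longrightarrow> w v i = w' v i) \<Longrightarrow> Q w \<longleftrightarrow> Q w'"
  shows "\<P>(w in coin_space G. Q w) =
    subset_mean (1/2) (nodes G \<times> {..<L}) (\<lambda>S. of_bool (Q (\<lambda>v i. (v, i) \<in> S)))"
proof -
  interpret prob_space "coin_space G" by (rule coin_space_prob_space)
  let ?K = "nodes G \<times> {..<L}"
  define C where "C S = {w \<in> space (coin_space G). \<forall>v\<in>nodes G. \<forall>i<L. w v i \<longleftrightarrow> (v, i) \<in> S}" for S
  define I where "I = {S \<in> Pow ?K. Q (\<lambda>v i. (v, i) \<in> S)}"
  have fin: "finite ?K" "finite I" using assms(1) by (auto simp: I_def)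
  have "{w \<in> space (coin_space G). Q w} = (\<Union>S\<in>I. C S)"
  proof (intro equalityI subsetI)
    fix w assume w: "w \<in> {w \<in> space (coin_space G). Q w}"
    let ?S = "{(v, i) \<in> ?K. w v i}"
    have "Q w \<longleftrightarrow> Q (\<lambda>v i. (v, i) \<in> ?S)" by (rule local) auto
    then have "?S \<in> I" using w by (auto simp: I_def)
    moreover have "w \<in> C ?S" using w by (auto simp: C_def)
    ultimately show "w \<in> (\<Union>S\<in>I. C S)" by blast
  next
    fix w assume "w \<in> (\<Union>S\<in>I. C S)"
    then obtain S where S: "S \<in> I" "w \<in> C S" by blast
    then have "Q w \<longleftrightarrow> Q (\<lambda>v i. (v, i) \<in> S)" by (intro local) (auto simp: C_def)
    with S show "w \<in> {w \<in> space (coin_space G). Q w}" by (auto simp: I_def C_def)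
  qed
  then have "\<P>(w in coin_space G. Q w) = prob (\<Union>S\<in>I. C S)" by simp
  also have "\<dots> = (\<Sum>S\<in>I. prob (C S))"
  proof (rule finite_measure_finite_Union)
    show "C ` I \<subseteq> events"
      unfolding C_def using coin_space_cylinder(1)[OF assms(1)] by blast
    show "disjoint_family_on C I"
      unfolding disjoint_family_on_def
    proof (intro ballI impI)
      fix S S' assume "S \<in> I" "S' \<in> I" "S \<noteq> S'"
      then obtain v i where "v \<in> nodes G" "i < L" "(v, i) \<in> S \<longleftrightarrow> (v, i) \<notin> S'"
        unfolding I_def by blast
      then show "C S \<inter> C S' = {}" by (auto simp: C_def)
    qed
  qed (rule fin)
  also have "\<dots> = (\<Sum>S\<in>I. (1/2) ^ card ?K)"
    by (simp add: C_def coin_space_cylinder(2)[OF assms(1)] card_cartesian_product)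
  also have "\<dots> = (\<Sum>S\<in>Pow ?K. (1/2) ^ card ?K * of_bool (Q (\<lambda>v i. (v, i) \<in> S)))"
    unfolding I_def using fin(1) by (intro sum.mono_neutral_cong_left) auto
  also have "\<dots> = subset_mean (1/2) ?K (\<lambda>S. of_bool (Q (\<lambda>v i. (v, i) \<in> S)))"
    unfolding subset_mean_def
  \<comment> \<open>For fair coins every pattern has the same weight,
    \<open>(1/2) ^ card ?K\<close>.\<close>
  proof (rule sum.cong)
    fix S assume "S \<in> Pow ?K"
    then have "card S + card (?K - S) = card ?K"
      using fin(1) by (metis PowD card_Diff_subset card_mono finite_subset le_add_diff_inverse)
    then show "(1/2) ^ card ?K * of_bool (Q (\<lambda>v i. (v, i) \<in> S)) =
        (1/2) ^ card S * (1 - 1/2 :: real) ^ card (?K - S) * of_bool (Q (\<lambda>v i. (v, i) \<in> S))"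
      by (simp flip: power_add)
  qed simp
  finally show ?thesis .
qed

section \<open>The phases as a process on vertex sets\<close>

definition open_nodes :: "(nat \<Rightarrow> nat set) \<Rightarrow> nat set \<Rightarrow> nat set \<Rightarrow> nat set" where
  "open_nodes N V I = {v \<in> V. v \<notin> I \<and> N v \<inter> I = {}}"

text \<open>The condition \<open>0 < r v\<close> lets a silent decided neighbour pass for one with
  value zero: such a neighbour never prevents a win.\<close>

definition winners :: "(nat \<Rightarrow> nat set) \<Rightarrow> nat set \<Rightarrow> (nat \<Rightarrow> nat) \<Rightarrow> nat set" where
  "winners N U r = {v \<in> U. 0 < r v \<and> (\<forall>u\<in>N v \<inter> U. r u < r v)}"

primrec chosen :: "(nat \<Rightarrow> nat set) \<Rightarrow> nat set \<Rightarrow> (nat \<Rightarrow> nat \<Rightarrow> nat) \<Rightarrow> nat \<Rightarrow> nat set" where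
  "chosen N V r 0 = {}"
| "chosen N V r (Suc t) =
    chosen N V r t \<union> winners N (open_nodes N V (chosen N V r t)) (r t)"

lemma chosen_subset: "chosen N V r t \<subseteq> V"
  by (induction t) (auto simp: winners_def open_nodes_def)

text \<open>Winners are open, so they have no neighbour among the nodes chosen before; two adjacent
  winners of the same phase would each have the strictly larger value.\<close>

lemma chosen_independent:
  assumes sym: "\<And>u v. u \<in> N v \<longleftrightarrow> v \<in> N u"
  shows "u \<in> chosen N V r t \<Longrightarrow> v \<in> chosen N V r t \<Longrightarrow> u \<notin> N v"
proof (induction t arbitrary: u v)
  case (Suc t)
  let ?I = "chosen N V r t"
  let ?W = "winners N (open_nodes N V ?I) (r t)"
  have "u \<notin> N v" if "u \<in> ?I" "v \<in> ?W" for u v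
    using that by (auto simp: winners_def open_nodes_def)
  moreover have "u \<notin> N v" if "u \<in> ?W" "v \<in> ?W" for u v
    using that sym[of u v] unfolding winners_def by (metis (no_types, lifting) Int_iff mem_Collect_eq order_less_asym)
  ultimately show ?case
    using Suc sym[of u v] by auto
qed simp

lemma chosen_cong:
  assumes "\<And>s v. s < t \<Longrightarrow> v \<in> V \<Longrightarrow> r s v = r' s v"
  shows "chosen N V r t = chosen N V r' t"
  using assms
proof (induction t)
  case (Suc t)
  have "winners N U (r t) = winners N U (r' t)" if "U \<subseteq> V" for U
    using Suc.prems[of t] that unfolding winners_def
    by (intro Collect_cong conj_cong ball_cong refl) (metis IntD2 lessI subsetD)+
  moreover have "open_nodes N V I \<subseteq> V" for I
    by (auto simp: open_nodes_def)
  ultimately show ?case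
    using Suc by simp
qed simp

definition streak :: "nat \<Rightarrow> (nat \<Rightarrow> bool) \<Rightarrow> nat \<Rightarrow> nat" where
  "streak m r t = length (takeWhile r [t * m..<t * m + m])"

lemma streak_le: "streak m r t \<le> m"
  unfolding streak_def using length_takeWhile_le[of r "[t * m..<t * m + m]"] by simp

text \<open>Being marked, \<open>j \<le> streak m r t\<close>, is thus decided by the first
  \<open>j\<close> coins of the block alone, and the remaining ones can be averaged out.\<close>

lemma le_streak_iff:
  assumes "j \<le> m"
  shows "j \<le> streak m r t \<longleftrightarrow> (\<forall>i\<in>{t * m..<t * m + j}. r i)"
proof -
  let ?xs = "[t * m..<t * m + m]"
  show ?thesis
  proof
    assume j: "j \<le> streak m r t"
    show "\<forall>i\<in>{t * m..<t * m + j}. r i"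
    proof
      fix i assume i: "i \<in> {t * m..<t * m + j}"
      then have "i - t * m < length (takeWhile r ?xs)"
        using j unfolding streak_def by auto
      then have "takeWhile r ?xs ! (i - t * m) = ?xs ! (i - t * m)" "r (takeWhile r ?xs ! (i - t * m))"
        using nth_mem set_takeWhileD by (metis takeWhile_nth, metis)
      then show "r i" using i assms by auto
    qed
  next
    assume r: "\<forall>i\<in>{t * m..<t * m + j}. r i"
    have "?xs = [t * m..<t * m + j] @ [t * m + j..<t * m + m]"
      using assms upt_add_eq_append[of "t * m" "t * m + j" "m - j"] by simp
    moreover have "takeWhile r ([t * m..<t * m + j] @ ys) = [t * m..<t * m + j] @ takeWhile r ys" for ys
      using r by (intro takeWhile_append2) simp
    ultimately show "j \<le> streak m r t"
      unfolding streak_def by (metis length_append length_upt diff_add_inverse le_add1)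
  qed
qed

lemma streak_cong:
  assumes "\<And>i. t * m \<le> i \<Longrightarrow> i < t * m + m \<Longrightarrow> r i = r' i"
  shows "streak m r t = streak m r' t"
  unfolding streak_def using assms by (intro arg_cong[where f = length] takeWhile_cong) auto

section \<open>Decay of the potential from phase to phase\<close>

text \<open>The marks outside \<open>U\<close> are averaged out; it is applied with the undecided
  nodes as \<open>U\<close>.\<close>

lemma subset_mean_Int:
  assumes "finite V" "U \<subseteq> V"
  shows "subset_mean p V (\<lambda>M. h (M \<inter> U)) = subset_mean p U h"
proof -
  have "subset_mean p (U \<union> (V - U)) (\<lambda>M. h (M \<inter> U)) =
      subset_mean p U (\<lambda>S. subset_mean p (V - U) (\<lambda>R. h ((S \<union> R) \<inter> U)))"
    using assms finite_subset by (intro subset_mean_Un) auto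
  also have "\<dots> = subset_mean p U (\<lambda>S. subset_mean p (V - U) (\<lambda>_. h S))"
    by (intro subset_mean_cong arg_cong[where f = h]) auto
  also have "\<dots> = subset_mean p U h"
    using assms(1) by simp
  also have "U \<union> (V - U) = V" using assms(2) by auto
  finally show ?thesis .
qed

text \<open>The past coins fix the undecided nodes, and the coins of the next phase are independent
  of them. The potential vanishes once \<open>a\<close> is reached; before that, at least
  \<open>b\<close> nodes are undecided, and \<open>subset_mean_isolated\<close> gives the factor
  \<open>(1 - p / 4) ^ card U \<le> exp (- p * b / 4)\<close> for the set \<open>U\<close> of these
  nodes.\<close>

lemma subset_mean_potential:
  fixes a b :: real and V :: "nat set" and N :: "nat \<Rightarrow> nat set" and m j :: nat
  defines "p \<equiv> (1/2 :: real) ^ j"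
    and "I \<equiv> \<lambda>t S. chosen N V (\<lambda>s v. streak m (\<lambda>i. (v, i) \<in> S) s) t"
  assumes fin: "finite V" and sym: "\<And>u v. u \<in> N v \<longleftrightarrow> v \<in> N u" and irrefl: "\<And>v. v \<notin> N v"
    and deg: "\<And>v. v \<in> V \<Longrightarrow> finite (N v) \<and> card (N v) \<le> D"
    and j: "0 < j" "j \<le> m" "8 * p * (real D + 1) \<le> 1"
    and many_open: "\<And>I. I \<subseteq> V \<Longrightarrow> real (card I) < a \<Longrightarrow> b \<le> real (card (open_nodes N V I))"
  shows "subset_mean (1/2) (V \<times> {..<t * m})
      (\<lambda>S. if a \<le> real (card (I t S)) then 0 else (1/2) ^ card (I t S)) \<le> exp (- p * b / 4) ^ t"
proof (induction t)
  case (Suc t)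
  define \<Phi> where "\<Phi> t S = (if a \<le> real (card (I t S)) then 0 else (1/2 :: real) ^ card (I t S))" for t S
  define J where "J = {t * m..<t * m + j}"
  define marks where "marks S = {v \<in> V. {v} \<times> J \<subseteq> S}" for S
  define isolated where "isolated M = {v \<in> M. N v \<inter> M = {}}" for M
  \<comment> \<open>The coins of past phases, the coins that decide the marks of phase
    \<open>t\<close>, and the rest of its block.\<close>
  let ?P = "V \<times> {..<t * m}" and ?Q = "V \<times> J" and ?R = "V \<times> {t * m + j..<t * m + m}"
  let ?U = "\<lambda>S. open_nodes N V (I t S)"
  have p: "0 \<le> p" "p \<le> 1" by (simp_all add: p_def power_le_one)
  have \<Phi>_nonneg: "0 \<le> \<Phi> t S" for t S by (simp add: \<Phi>_def)
  have U: "?U S \<subseteq> V" for S by (auto simp: open_nodes_def)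
  have split: "V \<times> {..<Suc t * m} = ?P \<union> (?Q \<union> ?R)" using j(2) by (auto simp: J_def)
  have step: "\<Phi> (Suc t) (S \<union> (S' \<union> S'')) \<le> \<Phi> t S * (1/2) ^ card (isolated (marks S' \<inter> ?U S))"
    if S: "S \<subseteq> ?P" "S' \<subseteq> ?Q" "S'' \<subseteq> ?R" for S S' S''
  proof -
    let ?S = "S \<union> (S' \<union> S'')"
    let ?r = "\<lambda>v. streak m (\<lambda>i. (v, i) \<in> ?S) t"
    let ?M = "marks S' \<inter> ?U S"
    \<comment> \<open>The blocks of the phases before \<open>t\<close> lie entirely below position
      \<open>t * m\<close>.\<close>
    have I_eq: "I t ?S = I t S"
      unfolding I_def
    proof (intro chosen_cong streak_cong)
      fix s v i assume "s < t" "s * m \<le> i" "i < s * m + m"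
      then have "i < Suc s * m" "Suc s * m \<le> t * m" by (simp, intro mult_right_mono) auto
      then have "i < t * m" by linarith
      then show "((v, i) \<in> ?S) = ((v, i) \<in> S)" using S by (auto simp: J_def)
    qed
    have mark_iff: "j \<le> ?r v \<longleftrightarrow> v \<in> marks S'" if "v \<in> V" for v
    proof -
      have "(v, i) \<in> ?S \<longleftrightarrow> (v, i) \<in> S'" if "i \<in> J" for i
        using that S by (auto simp: J_def)
      then show ?thesis
        unfolding le_streak_iff[OF j(2)] marks_def using \<open>v \<in> V\<close> by (auto simp: J_def)
    qed
    let ?W = "winners N (?U S) ?r"
    have Suc_eq: "I (Suc t) ?S = I t S \<union> ?W"
      using I_eq by (simp add: I_def)
    \<comment> \<open>A marked node has streak at least \<open>j\<close>, and its unmarked undecided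
      neighbours have less. So it wins, whatever the coins in \<open>?R\<close> are.\<close>
    have win: "isolated ?M \<subseteq> ?W"
    proof
      fix v assume v: "v \<in> isolated ?M"
      then have "v \<in> ?U S" "v \<in> marks S'" by (auto simp: isolated_def)
      with U mark_iff have rv: "j \<le> ?r v" by blast
      have "?r u < ?r v" if "u \<in> N v \<inter> ?U S" for u
      proof -
        have "u \<notin> marks S'" using v that by (auto simp: isolated_def)
        then have "\<not> j \<le> ?r u" using mark_iff[of u] that U[of S] by blast
        then show ?thesis using rv by linarith
      qed
      then show "v \<in> ?W"
        using rv j(1) \<open>v \<in> ?U S\<close> by (auto simp: winners_def)
    qed
    have fin_I: "finite (I t S)" "finite ?W"
      using fin finite_subset[OF chosen_subset] finite_subset[OF U]
      by (auto simp: I_def winners_def)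
    have "I t S \<inter> ?W = {}" by (auto simp: winners_def open_nodes_def)
    then have "card (I (Suc t) ?S) = card (I t S) + card ?W"
      unfolding Suc_eq using fin_I by (intro card_Un_disjoint)
    moreover have "card (isolated ?M) \<le> card ?W"
      using win fin_I by (intro card_mono)
    ultimately have le: "card (I t S) + card (isolated ?M) \<le> card (I (Suc t) ?S)" by simp
    then have "(1/2 :: real) ^ card (I (Suc t) ?S) \<le> (1/2) ^ (card (I t S) + card (isolated ?M))"
      by (intro power_decreasing) auto
    \<comment> \<open>If \<open>a\<close> is already reached after \<open>t\<close> phases, it stays
      reached and both sides are zero.\<close>
    with le show ?thesis
      by (auto simp: \<Phi>_def power_add)
  qed
  have round: "subset_mean (1/2) ?Q (\<lambda>S'. subset_mean (1/2) ?R (\<lambda>S''. \<Phi> (Suc t) (S \<union> (S' \<union> S''))))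
      \<le> exp (- p * b / 4) * \<Phi> t S" if S: "S \<subseteq> ?P" for S
  proof -
    let ?X = "\<lambda>M. (1/2 :: real) ^ card (isolated M)"
    \<comment> \<open>With \<open>S\<close> fixed, \<open>?U S\<close> is a constant set; the marks
      have probability \<open>p\<close>, and only those in \<open>?U S\<close> matter.\<close>
    have "subset_mean (1/2) ?Q (\<lambda>S'. ?X (marks S' \<inter> ?U S)) = subset_mean p V (\<lambda>M. ?X (M \<inter> ?U S))"
      unfolding marks_def
      using subset_mean_Times[OF fin, of J "1/2" "\<lambda>M. ?X (M \<inter> ?U S)"] by (simp add: J_def p_def)
    also have "\<dots> = subset_mean p (?U S) ?X"
      using fin U by (rule subset_mean_Int)
    also have "\<dots> \<le> (1 - p / 4) ^ card (?U S)"
      unfolding isolated_def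
    proof (rule subset_mean_isolated[OF _ p(1) j(3)])
      show "finite (?U S)" using fin U finite_subset by blast
      fix v assume "v \<in> ?U S"
      then have "v \<in> V" using U by blast
      then show "card (N v \<inter> ?U S) \<le> D"
        using deg[of v] card_mono[of "N v" "N v \<inter> ?U S"] by auto
    qed (use sym irrefl in auto)
    finally have mgf: "subset_mean (1/2) ?Q (\<lambda>S'. ?X (marks S' \<inter> ?U S)) \<le> (1 - p / 4) ^ card (?U S)" .
    have "subset_mean (1/2) ?Q (\<lambda>S'. subset_mean (1/2) ?R (\<lambda>S''. \<Phi> (Suc t) (S \<union> (S' \<union> S''))))
        \<le> subset_mean (1/2) ?Q (\<lambda>S'. subset_mean (1/2) ?R (\<lambda>S''. \<Phi> t S * ?X (marks S' \<inter> ?U S)))"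
      using S by (intro subset_mean_mono step) auto
    also have "\<dots> = \<Phi> t S * subset_mean (1/2) ?Q (\<lambda>S'. ?X (marks S' \<inter> ?U S))"
      using fin by (simp add: subset_mean_cmult)
    also have "\<dots> \<le> \<Phi> t S * (1 - p / 4) ^ card (?U S)"
      using mgf \<Phi>_nonneg by (intro mult_left_mono)
    also have "\<dots> \<le> \<Phi> t S * exp (- p * b / 4)"
    proof (cases "a \<le> real (card (I t S))")
      case False
      have "(1 - p / 4) ^ card (?U S) \<le> exp (- p / 4) ^ card (?U S)"
        using p exp_ge_add_one_self[of "- p / 4"] by (intro power_mono) auto
      also have "\<dots> = exp (- (p * real (card (?U S)) / 4))"
        by (simp add: exp_of_nat_mult[symmetric] mult.commute)
      also have "\<dots> \<le> exp (- p * b / 4)"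
        using many_open[of "I t S"] False p by (simp add: I_def chosen_subset mult_left_mono)
      finally show ?thesis using \<Phi>_nonneg by (intro mult_left_mono)
    qed (simp add: \<Phi>_def)
    finally show ?thesis by (simp only: mult.commute)
  qed
  have "subset_mean (1/2) (V \<times> {..<Suc t * m}) (\<Phi> (Suc t)) =
      subset_mean (1/2) ?P (\<lambda>S. subset_mean (1/2) ?Q (\<lambda>S'. subset_mean (1/2) ?R
        (\<lambda>S''. \<Phi> (Suc t) (S \<union> (S' \<union> S'')))))"
  proof -
    have "?P \<inter> (?Q \<union> ?R) = {}" "?Q \<inter> ?R = {}" by (auto simp: J_def)
    then show ?thesis
      unfolding split using fin by (simp add: subset_mean_Un J_def)
  qed
  also have "\<dots> \<le> subset_mean (1/2) ?P (\<lambda>S. exp (- p * b / 4) * \<Phi> t S)"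
    using round by (intro subset_mean_mono) auto
  also have "\<dots> = exp (- p * b / 4) * subset_mean (1/2) ?P (\<Phi> t)"
    by (rule subset_mean_cmult)
  also have "\<dots> \<le> exp (- p * b / 4) * exp (- p * b / 4) ^ t"
    using Suc.IH unfolding \<Phi>_def by (intro mult_left_mono) auto
  finally show ?case by (simp add: \<Phi>_def[abs_def])
qed (simp add: I_def)

section \<open>The distributed algorithm\<close>

text \<open>The length ensures \<open>16 * N \<le> 2 ^ block_length N\<close>. Hence the
  \<open>j\<close> of the analysis, with \<open>2 ^ j \<le> 16 * (\<Delta> + 1)\<close>, fits into a
  block although no node knows \<Delta>, while a streak in unary still has only O(log n)
  bits.\<close>

definition block_length :: "nat \<Rightarrow> nat" where
  "block_length N = nat \<lceil>log 2 (real N)\<rceil> + 4"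

definition own_streak :: "view \<Rightarrow> nat \<Rightarrow> nat" where
  "own_streak x t = streak (block_length (bound x)) (coins x) t"

text \<open>Phase \<open>t\<close> takes the rounds \<open>2 t\<close> and \<open>2 t + 1\<close>: the undecided nodes send their streaks in
  unary, so that a decided node, which stays silent, counts as one with streak zero; then the
  nodes that join the output set announce it.\<close>

definition beats :: "view \<Rightarrow> nat \<Rightarrow> bool" where
  "beats x t \<longleftrightarrow> 0 < own_streak x t \<and>
    (\<forall>msg\<in>set (received x ! (2 * t)). length msg < own_streak x t)"

text \<open>The phases are replayed from the recorded messages. Records are only appended, so every
  later view yields the same status.\<close>

primrec status :: "view \<Rightarrow> nat \<Rightarrow> bool option" where
  "status x 0 = None"
| "status x (Suc t) =
    (if status x t \<noteq> None then status x t
     else if beats x t then Some True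
     else if \<exists>msg\<in>set (received x ! (2 * t + 1)). msg \<noteq> [] then Some False
     else None)"

text \<open>The parity of the number of completed rounds tells the two rounds of a phase apart. In
  the second, \<open>status x t\<close> still describes the start of the phase, so a fresh winner is
  not silenced before it announces itself.\<close>

definition broadcast :: "view \<Rightarrow> bool list" where
  "broadcast x =
    (let t = length (received x) div 2 in
     if status x t \<noteq> None then []
     else if even (length (received x)) then replicate (own_streak x t) True
     else if beats x t then [True] else [])"

text \<open>All nodes decide at the same time, after \<open>T\<close> phases; those that are then
  still undecided stay out.\<close>

definition streak_algorithm :: "nat \<Rightarrow> congest_algorithm" where
  "streak_algorithm T =
    \<lparr>message = (\<lambda>x _. broadcast x),
     decision = (\<lambda>x. if length (received x) = 2 * T then Some (status x T = Some True) else None)\<rparr>"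

section \<open>The algorithm simulates the process\<close>

lemma streak_algorithm_simps [simp]:
  "message (streak_algorithm T) x i = broadcast x"
  "decision (streak_algorithm T) x =
    (if length (received x) = 2 * T then Some (status x T = Some True) else None)"
  by (simp_all add: streak_algorithm_def)

lemma view_after_simps [simp]:
  "bound (view_after A G w t v) = size_bound G"
  "coins (view_after A G w t v) = w v"
  "length (received (view_after A G w t v)) = t"
  by (induction t) auto

lemma received_nth:
  assumes "r < t"
  shows "received (view_after A G w t v) ! r =
    map (\<lambda>u. message A (view_after A G w r u) (port_to G u v)) (ports G v)"
  using assms
proof (induction t)
  case (Suc t)
  then show ?case by (cases "r = t") (simp_all add: nth_append)
qed simp

lemma valid_network_neighbours:
  assumes "valid_network k G"
  shows "u \<in> neighbours G v \<longleftrightarrow> v \<in> neighbours G u" "v \<notin> neighbours G v"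
    "neighbours G v \<subseteq> nodes G"
    "v \<in> nodes G \<Longrightarrow> set (ports G v) = neighbours G v"
proof -
  have edges: "e \<subseteq> nodes G \<and> card e = 2" if "e \<in> edges G" for e
    using assms that unfolding valid_network_def nsets_def by auto
  show "u \<in> neighbours G v \<longleftrightarrow> v \<in> neighbours G u"
    by (simp add: neighbours_def insert_commute)
  show "v \<notin> neighbours G v"
    using edges[of "{v}"] by (auto simp: neighbours_def)
  show "neighbours G v \<subseteq> nodes G"
    using edges by (fastforce simp: neighbours_def)
  show "v \<in> nodes G \<Longrightarrow> set (ports G v) = neighbours G v"
    using assms by (simp add: valid_network_def)
qed

definition chosen_nodes :: "network \<Rightarrow> (nat \<Rightarrow> nat \<Rightarrow> bool) \<Rightarrow> nat \<Rightarrow> nat set" where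
  "chosen_nodes G w =
    chosen (neighbours G) (nodes G) (\<lambda>t v. streak (block_length (size_bound G)) (w v) t)"

text \<open>Simulation invariant, for every view from round \<open>2 * t\<close> on: this generality
  in \<open>s\<close> lets the induction compare the views of sender and receiver, which are taken
  at different times.\<close>

lemma status_view_after:
  assumes valid: "valid_network k G" and "2 * t \<le> s" "v \<in> nodes G"
  shows "status (view_after (streak_algorithm T) G w s v) t =
    (if v \<in> chosen_nodes G w t then Some True
     else if neighbours G v \<inter> chosen_nodes G w t \<noteq> {} then Some False
     else None)"
  using assms(2,3)
proof (induction t arbitrary: s v)
  case 0
  then show ?case by (simp add: chosen_nodes_def)
next
  case (Suc t)
  let ?X = "view_after (streak_algorithm T) G w"
  let ?N = "neighbours G"
  define r where "r v = streak (block_length (size_bound G)) (w v) t" for v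
  define I where "I = chosen_nodes G w t"
  define U where "U = open_nodes ?N (nodes G) I"
  have Suc_I: "chosen_nodes G w (Suc t) = I \<union> winners ?N U r"
    by (simp add: chosen_nodes_def I_def U_def r_def[abs_def])
  have r: "own_streak (?X s v) t = r v" for s v
    by (simp add: own_streak_def r_def)
  have open_iff: "status (?X s v) t = None \<longleftrightarrow> v \<in> U" if "2 * t \<le> s" "v \<in> nodes G" for s v
    using Suc.IH[OF that] that(2) by (auto simp: U_def open_nodes_def I_def)
  have received: "set (received (?X s v) ! i) = (\<lambda>u. broadcast (?X i u)) ` ?N v"
    if "i < s" "v \<in> nodes G" for i s v
    using that valid_network_neighbours(4)[OF valid] by (simp add: received_nth)
  have streak_msg: "length (broadcast (?X (2 * t) u)) = (if u \<in> U then r u else 0)" if "u \<in> nodes G" for u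
    using open_iff[OF _ that, of "2 * t"] by (simp add: broadcast_def r del: not_None_eq)
  have beats_iff: "beats (?X s v) t \<longleftrightarrow> v \<in> winners ?N U r" if "2 * t < s" "v \<in> U" for s v
  proof -
    have v: "v \<in> nodes G" using that(2) by (simp add: U_def open_nodes_def)
    \<comment> \<open>A decided neighbour sends the empty string, whose length is below every
      positive streak.\<close>
    have "length (broadcast (?X (2 * t) u)) < r v \<longleftrightarrow> (u \<in> U \<longrightarrow> r u < r v)"
      if "u \<in> ?N v" "0 < r v" for u
      using streak_msg[of u] that valid_network_neighbours(3)[OF valid, of v] by auto
    then show ?thesis
      using that(2) unfolding beats_def r received[OF that(1) v] winners_def by auto
  qed
  \<comment> \<open>At the announcement the view has \<open>2 * t + 1\<close> entries, so entry
    \<open>2 * t\<close> with the streaks is already available.\<close>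
  have win_msg: "broadcast (?X (2 * t + 1) u) \<noteq> [] \<longleftrightarrow> u \<in> winners ?N U r" if "u \<in> nodes G" for u
  proof -
    have "u \<in> U" if "u \<in> winners ?N U r" using that by (simp add: winners_def)
    then show ?thesis
      using open_iff[OF _ that, of "2 * t + 1"] beats_iff[of "2 * t + 1" u]
      by (auto simp: broadcast_def Let_def)
  qed
  have announced: "(\<exists>msg\<in>set (received (?X s v) ! (2 * t + 1)). msg \<noteq> []) \<longleftrightarrow>
      ?N v \<inter> winners ?N U r \<noteq> {}"
    using received[of "2 * t + 1" s v] win_msg Suc.prems valid_network_neighbours(3)[OF valid, of v]
    by auto
  have IH: "status (?X s v) t = (if v \<in> I then Some True else if ?N v \<inter> I \<noteq> {} then Some False else None)"
    using Suc unfolding I_def by auto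
  show ?case
  proof (cases "v \<in> U")
    case True
    then have "v \<notin> I" "?N v \<inter> I = {}" by (auto simp: U_def open_nodes_def)
    moreover have "status (?X s v) t = None" using IH calculation by simp
    moreover have "beats (?X s v) t \<longleftrightarrow> v \<in> winners ?N U r"
      using Suc.prems True by (intro beats_iff) auto
    ultimately show ?thesis
      unfolding Suc_I status.simps announced by auto
  next
    \<comment> \<open>Decided nodes keep their status, and a node outside \<open>U\<close> cannot
      win.\<close>
    case False
    then have "v \<notin> winners ?N U r" "status (?X s v) t \<noteq> None"
      using open_iff[of s v] Suc.prems by (auto simp: winners_def)
    moreover have "v \<in> I \<or> ?N v \<inter> I \<noteq> {}"
      using False Suc.prems by (auto simp: U_def open_nodes_def)
    ultimately show ?thesis
      unfolding Suc_I using IH by auto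
  qed
qed

lemma output_set_streak_algorithm:
  assumes "valid_network k G"
  shows "output_set (streak_algorithm T) G w = chosen_nodes G w T"
proof -
  have "chosen_nodes G w T \<subseteq> nodes G"
    unfolding chosen_nodes_def by (rule chosen_subset)
  moreover have "status (view_after (streak_algorithm T) G w (2 * T) v) T = Some True \<longleftrightarrow>
      v \<in> chosen_nodes G w T" if "v \<in> nodes G" for v
    using status_view_after[OF assms _ that, of T "2 * T" T w] by simp
  ultimately show ?thesis
    unfolding output_set_def by (auto split: if_splits)
qed

lemma rounds_le_streak_algorithm:
  assumes "real (2 * T) \<le> R"
  shows "rounds_le (streak_algorithm T) G R"
  unfolding rounds_le_def
  using assms by (auto intro!: exI[of _ "2 * T"])

lemma bandwidth_le_streak_algorithm:
  assumes "real (block_length (size_bound G)) \<le> L"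
  shows "bandwidth_le (streak_algorithm T) G L"
proof -
  have "length (broadcast x) \<le> block_length (bound x)" for x
    by (auto simp: broadcast_def Let_def own_streak_def streak_le) (simp add: block_length_def)
  then have msg: "length (message (streak_algorithm T) x i) \<le> block_length (bound x)" for x i
    by simp
  have "real (length (message (streak_algorithm T) (view_after (streak_algorithm T) G w t v) i)) \<le> L"
    for w t v i
    using msg[of "view_after (streak_algorithm T) G w t v" i] assms by simp
  then show ?thesis
    unfolding bandwidth_le_def by blast
qed

section \<open>Bounds on messages, degrees and undecided nodes\<close>

lemma two_power_block_length:
  assumes "1 \<le> N"
  shows "16 * N \<le> 2 ^ block_length N"
proof -
  have "real N \<le> 2 powr real_of_int \<lceil>log 2 (real N)\<rceil>"
    using assms by (simp flip: log_le_iff)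
  also have "\<dots> = 2 ^ nat \<lceil>log 2 (real N)\<rceil>"
    using assms by (simp flip: powr_realpow)
  finally have "real N \<le> real (2 ^ nat \<lceil>log 2 (real N)\<rceil>)" by simp
  then show ?thesis
    unfolding of_nat_le_iff by (simp add: block_length_def power_add)
qed

lemma block_length_le:
  assumes "valid_network k G" "2 \<le> card (nodes G)"
  shows "real (block_length (size_bound G)) \<le> (log 2 (real k) + real k + 5) * log 2 (real (card (nodes G)))"
proof -
  let ?n = "card (nodes G)" and ?N = "size_bound G"
  have N: "?n \<le> ?N" "?N \<le> k * ?n ^ k"
    using assms by (auto simp: valid_network_def)
  then have k: "1 \<le> k" using assms(2) by (cases k) auto
  have log_n: "1 \<le> log 2 (real ?n)"
    using assms(2) by (simp add: le_log_iff)
  have log_k: "0 \<le> log 2 (real k)"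
    using k by simp
  have log_N: "0 \<le> log 2 (real ?N)"
    using N assms(2) by simp
  have "log 2 (real ?N) \<le> log 2 (real (k * ?n ^ k))"
    using N k assms(2) by (subst log_le_cancel_iff) (auto simp flip: of_nat_mult of_nat_power)
  also have "\<dots> = log 2 (real k) + real k * log 2 (real ?n)"
    using k assms(2) by (simp add: log_mult log_nat_power)
  finally have le: "log 2 (real ?N) \<le> log 2 (real k) + real k * log 2 (real ?n)" .
  \<comment> \<open>The additive 4 plus at most 1 for rounding up; it is absorbed below by
    \<open>1 \<le> log 2 (real ?n)\<close>.\<close>
  have "real (block_length ?N) \<le> log 2 (real ?N) + 5"
    using log_N unfolding block_length_def by linarith
  also have "\<dots> \<le> (log 2 (real k) + 5) * 1 + real k * log 2 (real ?n)"
    using le by simp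
  also have "\<dots> \<le> (log 2 (real k) + 5) * log 2 (real ?n) + real k * log 2 (real ?n)"
    using log_n log_k by (intro add_mono mult_left_mono) auto
  finally show ?thesis by (simp add: algebra_simps)
qed

lemma degree_le_max_degree:
  assumes "valid_network k G" "v \<in> nodes G"
  shows "finite (neighbours G v)" "card (neighbours G v) \<le> max_degree G"
    "card (neighbours G v) + 1 \<le> card (nodes G)"
proof -
  have fin: "finite (nodes G)" using assms by (simp add: valid_network_def)
  then show "finite (neighbours G v)"
    using valid_network_neighbours(3)[OF assms(1)] finite_subset by blast
  show "card (neighbours G v) \<le> max_degree G"
    using fin assms(2) unfolding max_degree_def degree_def by (intro Max_ge) auto
  have "card (neighbours G v) \<le> card (nodes G - {v})"
    using fin valid_network_neighbours(2,3)[OF assms(1)] by (intro card_mono) auto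
  then show "card (neighbours G v) + 1 \<le> card (nodes G)"
    using card_Suc_Diff1[OF fin assms(2)] by linarith
qed

lemma max_degree_less:
  assumes "valid_network k G"
  shows "max_degree G < card (nodes G)"
proof -
  have "finite (degree G ` nodes G)" "degree G ` nodes G \<noteq> {}"
    using assms by (auto simp: valid_network_def)
  then have "max_degree G \<in> degree G ` nodes G"
    unfolding max_degree_def by (rule Max_in)
  then show ?thesis
    using degree_le_max_degree(3)[OF assms] by (auto simp: degree_def Suc_le_eq)
qed

text \<open>Every decided node lies in \<open>I\<close> or next to it, so at most
  \<open>card I * (\<Delta> + 1) < n / (1 + \<epsilon>)\<close> nodes are decided, which is at most
  \<open>n * (1 - \<epsilon> / 2)\<close>.\<close>

lemma card_open_nodes:
  assumes valid: "valid_network k G" and I: "I \<subseteq> nodes G"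
    and card: "real (card I) < real (card (nodes G)) / ((1 + \<epsilon>) * (real (max_degree G) + 1))"
    and \<epsilon>: "0 < \<epsilon>" "\<epsilon> \<le> 1"
  shows "\<epsilon> * real (card (nodes G)) / 2 \<le> real (card (open_nodes (neighbours G) (nodes G) I))"
proof -
  let ?n = "card (nodes G)" and ?D = "max_degree G"
  let ?U = "open_nodes (neighbours G) (nodes G) I"
  have fin: "finite (nodes G)" "finite I" using valid I finite_subset by (auto simp: valid_network_def)
  have "nodes G \<subseteq> ?U \<union> (I \<union> (\<Union>v\<in>I. neighbours G v))"
    using valid_network_neighbours(1)[OF valid] by (fastforce simp: open_nodes_def)
  then have "?n \<le> card (?U \<union> (I \<union> (\<Union>v\<in>I. neighbours G v)))"
    using fin I degree_le_max_degree(1)[OF valid]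
    by (intro card_mono) (auto simp: open_nodes_def)
  also have "\<dots> \<le> card ?U + (card I + card (\<Union>v\<in>I. neighbours G v))"
    by (meson card_Un_le add_left_mono order_trans)
  also have "card (\<Union>v\<in>I. neighbours G v) \<le> (\<Sum>v\<in>I. card (neighbours G v))"
    using fin by (intro card_UN_le)
  also have "\<dots> \<le> (\<Sum>v\<in>I. ?D)"
    using degree_le_max_degree(2)[OF valid] I by (intro sum_mono) auto
  finally have "?n \<le> card ?U + card I * (?D + 1)" by simp
  then have "real ?n \<le> real (card ?U + card I * (?D + 1))" by (rule of_nat_mono)
  then have "real ?n \<le> real (card ?U) + real (card I) * (real ?D + 1)"
    unfolding of_nat_add of_nat_mult of_nat_1 .
  moreover have "(1 + \<epsilon>) * (real (card I) * (real ?D + 1)) \<le> real ?n"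
  proof -
    have "0 < (1 + \<epsilon>) * (real ?D + 1)" using \<epsilon> by (intro mult_pos_pos) auto
    then have "real (card I) * ((1 + \<epsilon>) * (real ?D + 1)) < real ?n"
      using card by (simp only: pos_less_divide_eq)
    then show ?thesis by (simp only: mult_ac less_imp_le)
  qed
  \<comment> \<open>\<open>(1 + \<epsilon>) * (1 - \<epsilon> / 2) = 1 + \<epsilon> * (1 -
    \<epsilon>) / 2\<close>; this uses \<open>\<epsilon> \<le> 1\<close>.\<close>
  moreover have "real ?n \<le> (1 + \<epsilon>) * (real ?n - \<epsilon> * real ?n / 2)"
  proof -
    have "0 \<le> \<epsilon> * (1 - \<epsilon>) * real ?n / 2" using \<epsilon> by simp
    then show ?thesis by (simp add: algebra_simps)
  qed
  ultimately have "(1 + \<epsilon>) * (real (card I) * (real ?D + 1)) \<le> (1 + \<epsilon>) * (real ?n - \<epsilon> * real ?n / 2)"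
    by linarith
  then have "real (card I) * (real ?D + 1) \<le> real ?n - \<epsilon> * real ?n / 2"
    using \<epsilon> by (simp only: mult_le_cancel_left_pos)
  with \<open>real ?n \<le> real (card ?U) + _\<close> show ?thesis by linarith
qed

text \<open>The degree hypothesis enters here: adding \<open>D * log 2 n \<le> n\<close> and
  \<open>log 2 n \<le> n\<close> gives \<open>(D + 1) * log 2 n \<le> 2 * n\<close>. A decay
  exponential in \<open>n / (D + 1)\<close> is therefore polynomial in \<open>1 / n\<close>.\<close>

lemma ln_le_twice_ratio:
  fixes n :: nat and D :: real
  assumes "2 \<le> n" "0 \<le> D" "D \<le> real n / log 2 (real n)"
  shows "ln (real n) \<le> 2 * (real n / (D + 1))"
proof -
  let ?l = "log 2 (real n)"
  have l: "0 < ?l" using assms(1) by simp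
  have "real n \<le> 2 powr real n"
    using less_exp[of n] by (simp add: powr_realpow)
  then have "?l \<le> real n"
    using assms(1) by (simp add: log_le_iff)
  moreover have "D * ?l \<le> real n"
    using assms(3) l by (simp add: pos_le_divide_eq)
  ultimately have "?l * (D + 1) \<le> 2 * real n"
    by (simp add: algebra_simps)
  then have "?l \<le> 2 * (real n / (D + 1))"
    using assms(2) by (simp add: pos_le_divide_eq)
  moreover have "ln (real n) \<le> ?l"
  proof -
    have "ln (real n) = ?l * ln 2" by (simp add: log_def)
    also have "\<dots> \<le> ?l * 1"
      using l ln_le_minus_one[of "2 :: real"] by (intro mult_left_mono) auto
    finally show ?thesis by simp
  qed
  ultimately show ?thesis by linarith
qed

section \<open>Failure probability and choice of constants\<close>

text \<open>Markov's inequality for the potential: on failure it is at least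
  \<open>exp (- x)\<close>, and its mean decreases by the factor
  \<open>exp (- p * \<epsilon> * n / 8)\<close> per phase.\<close>

lemma chosen_nodes_fail:
  fixes c \<epsilon> :: real and G :: network
  defines "n \<equiv> real (card (nodes G))" and "D \<equiv> max_degree G"
  defines "a \<equiv> n / ((1 + \<epsilon>) * (real D + 1))"
  assumes valid: "valid_network k G" and two: "2 \<le> card (nodes G)"
    and D: "real D \<le> n / log 2 n" and \<epsilon>: "0 < \<epsilon>" "\<epsilon> \<le> 1" and c: "1 < c"
    and T: "128 * (2 * c + 1) / \<epsilon> \<le> real T"
  shows "subset_mean (1/2) (nodes G \<times> {..<T * block_length (size_bound G)})
      (\<lambda>S. of_bool (real (card (chosen_nodes G (\<lambda>v i. (v, i) \<in> S) T)) < a)) \<le> 1 / n powr c"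
proof -
  define m where "m = block_length (size_bound G)"
  define x where "x = n / (real D + 1)"
  let ?K = "nodes G \<times> {..<T * m}"
  let ?C = "\<lambda>S. card (chosen_nodes G (\<lambda>v i. (v, i) \<in> S) T)"
  let ?\<Phi> = "\<lambda>S. if a \<le> real (?C S) then 0 else (1/2 :: real) ^ ?C S"
  have fin: "finite (nodes G)" using valid by (simp add: valid_network_def)
  have n: "2 \<le> n" using two by (simp add: n_def)
  \<comment> \<open>The power \<open>2 ^ (i + 1)\<close> lies between \<open>8 * (D + 1)\<close> and
    \<open>16 * (D + 1)\<close>: large enough for \<open>subset_mean_isolated\<close>, yet
    \<open>p\<close> stays of order \<open>1 / (D + 1)\<close>.\<close>
  obtain i where i: "2 ^ i \<le> 8 * (D + 1)" "8 * (D + 1) < 2 ^ (i + 1)"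
    using ex_power_ivl1[of 2 "8 * (D + 1)"] by auto
  define j where "j = i + 1"
  define p where "p = (1/2 :: real) ^ j"
  have "D + 1 \<le> size_bound G"
    using max_degree_less[OF valid] valid by (simp add: D_def valid_network_def)
  then have "(2 :: nat) ^ j \<le> 2 ^ m"
    using i(1) two_power_block_length[of "size_bound G"] by (simp add: j_def m_def)
  then have j: "0 < j" "j \<le> m"
    using power_le_imp_le_exp[of "2 :: nat" j m] by (simp_all add: j_def)
  have pow: "8 * (real D + 1) \<le> 2 ^ j" "2 ^ j \<le> 16 * (real D + 1)"
  proof -
    have "real (8 * (D + 1)) \<le> real (2 ^ j)" "real (2 ^ j) \<le> real (16 * (D + 1))"
      unfolding of_nat_le_iff using i by (simp_all add: j_def)
    then show "8 * (real D + 1) \<le> 2 ^ j" "2 ^ j \<le> 16 * (real D + 1)" by simp_all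
  qed
  then have p: "8 * p * (real D + 1) \<le> 1" "1 / (16 * (real D + 1)) \<le> p"
    by (simp_all add: p_def power_one_over field_simps)
  have x: "0 \<le> x" using n by (simp add: x_def)
  have "a \<le> x"
  proof -
    have "1 * (real D + 1) \<le> (1 + \<epsilon>) * (real D + 1)"
      using \<epsilon> by (intro mult_right_mono) auto
    then show ?thesis
      unfolding a_def x_def using n by (intro divide_left_mono) (auto simp: add_pos_pos)
  qed
  \<comment> \<open>On failure fewer than \<open>a \<le> x\<close> nodes are chosen, and
    \<open>exp (- 1) \<le> 1/2\<close>. The base e in place of 2 weakens the bound but keeps all
    factors exponentials.\<close>
  have pointwise: "of_bool (real (?C S) < a) \<le> exp x * ?\<Phi> S" for S
  proof (cases "real (?C S) < a")
    case True
    have "exp (- x) \<le> exp (- real (?C S))"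
      using True \<open>a \<le> x\<close> by simp
    also have "\<dots> = exp (- 1) ^ ?C S"
      by (simp add: exp_of_nat_mult[symmetric])
    also have "\<dots> \<le> (1/2) ^ ?C S"
    proof (intro power_mono)
      have "(2 :: real) \<le> exp 1" using exp_ge_add_one_self[of 1] by simp
      then show "exp (- 1) \<le> (1/2 :: real)" by (simp add: exp_minus field_simps)
    qed simp
    finally show ?thesis using True by (simp add: exp_minus field_simps)
  qed simp
  have potential: "subset_mean (1/2) ?K ?\<Phi> \<le> exp (- p * (\<epsilon> * n / 2) / 4) ^ T"
    unfolding chosen_nodes_def m_def[symmetric]
  proof (unfold p_def, rule subset_mean_potential)
    show "0 < j" "j \<le> m" "8 * (1/2) ^ j * (real D + 1) \<le> 1"
      using j p(1) by (simp_all add: p_def)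
    show "u \<in> neighbours G v \<longleftrightarrow> v \<in> neighbours G u" "v \<notin> neighbours G v" for u v
      using valid_network_neighbours[OF valid] by auto
    show "finite (neighbours G v) \<and> card (neighbours G v) \<le> D" if "v \<in> nodes G" for v
      using degree_le_max_degree[OF valid that] by (simp add: D_def)
    show "\<epsilon> * n / 2 \<le> real (card (open_nodes (neighbours G) (nodes G) I))"
      if "I \<subseteq> nodes G" "real (card I) < a" for I
      using card_open_nodes[OF valid that(1) _ \<epsilon>] that(2) by (simp add: a_def n_def D_def)
  qed (rule fin)
  \<comment> \<open>The 128 is 16 from the lower bound on \<open>p\<close> times 8 from the decay
    exponent. Of the resulting \<open>2 * c + 1\<close> multiples of \<open>x\<close>, one pays for
    the Markov factor \<open>exp x\<close> and \<open>2 * c\<close> cover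
    \<open>c * ln n\<close>.\<close>
  have "(2 * c + 1) * x \<le> p * \<epsilon> * n * real T / 8"
  proof -
    have "128 * (2 * c + 1) \<le> \<epsilon> * real T"
      using T \<epsilon> by (simp add: pos_divide_le_eq mult.commute)
    then have "(1 / (16 * (real D + 1))) * (128 * (2 * c + 1)) \<le> p * (\<epsilon> * real T)"
      using p(2) c \<epsilon> by (intro mult_mono[of _ p]) (simp_all add: p_def)
    then have "(1 / (16 * (real D + 1))) * (128 * (2 * c + 1)) * (n / 8) \<le> p * (\<epsilon> * real T) * (n / 8)"
      using n by (intro mult_right_mono) auto
    also have "(1 / (16 * (real D + 1))) * (128 * (2 * c + 1)) * (n / 8) = (2 * c + 1) * x"
      by (simp add: x_def field_simps)
    finally show ?thesis by (simp add: algebra_simps)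
  qed
  moreover have "ln n \<le> 2 * x"
    unfolding x_def n_def by (rule ln_le_twice_ratio) (use two D in \<open>auto simp: n_def\<close>)
  then have "c * ln n \<le> c * (2 * x)" using c by (intro mult_left_mono) auto
  ultimately have exponent: "x - p * \<epsilon> * n * real T / 8 \<le> - (c * ln n)"
    by (simp add: algebra_simps)
  have "subset_mean (1/2) ?K (\<lambda>S. of_bool (real (?C S) < a)) \<le> subset_mean (1/2) ?K (\<lambda>S. exp x * ?\<Phi> S)"
    using pointwise by (intro subset_mean_mono) auto
  also have "\<dots> \<le> exp x * exp (- p * (\<epsilon> * n / 2) / 4) ^ T"
    unfolding subset_mean_cmult using potential by (intro mult_left_mono) auto
  also have "\<dots> = exp (x - p * \<epsilon> * n * real T / 8)"
    by (simp add: exp_of_nat_mult[symmetric] exp_add[symmetric] algebra_simps)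
  also have "\<dots> \<le> exp (- (c * ln n))"
    using exponent by simp
  also have "\<dots> = 1 / n powr c"
    using n by (simp add: powr_def exp_minus divide_inverse)
  finally show ?thesis by (simp add: m_def)
qed

lemma chosen_nodes_cong:
  assumes "\<And>v i. v \<in> nodes G \<Longrightarrow> i < T * block_length (size_bound G) \<Longrightarrow> w v i = w' v i"
  shows "chosen_nodes G w T = chosen_nodes G w' T"
  unfolding chosen_nodes_def
proof (intro chosen_cong streak_cong assms)
  fix s v i
  let ?m = "block_length (size_bound G)"
  assume "s < T" "i < s * ?m + ?m"
  then have "i < Suc s * ?m" "Suc s * ?m \<le> T * ?m" by (simp, intro mult_right_mono) auto
  then show "i < T * ?m" by linarith
qed

lemma indep_chosen_nodes:
  assumes "valid_network k G"
  shows "indep (chosen_nodes G w T) (edges G)"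
proof -
  have "{u, v} \<notin> edges G" if "u \<in> chosen_nodes G w T" "v \<in> chosen_nodes G w T" for u v
    using that chosen_independent[of "neighbours G", OF valid_network_neighbours(1)[OF assms]]
    unfolding chosen_nodes_def by (auto simp: neighbours_def)
  then show ?thesis by (simp add: indep_def)
qed

theorem theorem5:
  fixes c :: real and k :: nat
  assumes "c > 1"
  shows "\<exists>C B :: real. \<forall>\<epsilon> :: real. 0 < \<epsilon> \<and> \<epsilon> \<le> 1 \<longrightarrow>
    (\<exists>A :: congest_algorithm.
      (\<forall>G. valid_network k G \<longrightarrow>
         bandwidth_le A G (B * log 2 (real (card (nodes G)))) \<and> rounds_le A G (C / \<epsilon>)) \<and>
      (\<forall>G. valid_network k G \<and>
           real (max_degree G) \<le> real (card (nodes G)) / log 2 (real (card (nodes G))) \<longrightarrow>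
         \<P>(w in coin_space G.
             indep (output_set A G w) (edges G) \<and>
             real (card (output_set A G w))
               \<ge> real (card (nodes G)) / ((1 + \<epsilon>) * (real (max_degree G) + 1)))
           \<ge> 1 - 1 / real (card (nodes G)) powr c))"
proof (intro exI allI impI)
  fix \<epsilon> :: real
  assume \<epsilon>: "0 < \<epsilon> \<and> \<epsilon> \<le> 1"
  define K where "K = 128 * (2 * c + 1)"
  define T where "T = nat \<lceil>K / \<epsilon>\<rceil>"
  let ?A = "streak_algorithm T"
  have K: "0 < K" using assms by (simp add: K_def)
  then have "0 < K / \<epsilon>" using \<epsilon> by simp
  then have T: "K / \<epsilon> \<le> real T" "real T \<le> K / \<epsilon> + 1"
    unfolding T_def by linarith+
  \<comment> \<open>This instantiates \<open>B\<close> by \<open>log 2 k + k + 5\<close> and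
    \<open>C\<close> by \<open>2 * (128 * (2 * c + 1) + 1)\<close>, both independent of
    \<epsilon>.\<close>
  show "(\<forall>G. valid_network k G \<longrightarrow>
         bandwidth_le ?A G ((log 2 (real k) + real k + 5) * log 2 (real (card (nodes G)))) \<and>
         rounds_le ?A G ((2 * (128 * (2 * c + 1) + 1)) / \<epsilon>)) \<and>
      (\<forall>G. valid_network k G \<and>
           real (max_degree G) \<le> real (card (nodes G)) / log 2 (real (card (nodes G))) \<longrightarrow>
         \<P>(w in coin_space G.
             indep (output_set ?A G w) (edges G) \<and>
             real (card (output_set ?A G w))
               \<ge> real (card (nodes G)) / ((1 + \<epsilon>) * (real (max_degree G) + 1)))
           \<ge> 1 - 1 / real (card (nodes G)) powr c)"
  proof (intro conjI allI impI)
    fix G assume valid: "valid_network k G"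
    show "bandwidth_le ?A G ((log 2 (real k) + real k + 5) * log 2 (real (card (nodes G))))"
    proof (cases "2 \<le> card (nodes G)")
      case True
      then show ?thesis by (intro bandwidth_le_streak_algorithm block_length_le valid)
    next
      \<comment> \<open>A single node has no ports, so the bound, which is
        \<open>log 2 1 = 0\<close> up to the factor, holds vacuously.\<close>
      case False
      then have "degree G v = 0" if "v \<in> nodes G" for v
        using degree_le_max_degree(3)[OF valid that] by (simp add: degree_def)
      then show ?thesis by (simp add: bandwidth_le_def)
    qed
    have "2 * real T \<le> 2 * (K / \<epsilon> + 1)" using T by simp
    \<comment> \<open>Since \<open>\<epsilon> \<le> 1\<close>, the loss from rounding
      \<open>T\<close> up is at most \<open>1 / \<epsilon>\<close>.\<close>
    also have "\<dots> \<le> 2 * (K + 1) / \<epsilon>"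
      using \<epsilon> by (simp add: field_simps)
    finally show "rounds_le ?A G ((2 * (128 * (2 * c + 1) + 1)) / \<epsilon>)"
      by (intro rounds_le_streak_algorithm) (simp add: K_def)
  next
    fix G
    let ?n = "real (card (nodes G))" and ?D = "real (max_degree G)"
    let ?a = "?n / ((1 + \<epsilon>) * (?D + 1))"
    assume "valid_network k G \<and> ?D \<le> ?n / log 2 ?n"
    then have valid: "valid_network k G" and D: "?D \<le> ?n / log 2 ?n" by auto
    have fin: "finite (nodes G)" "nodes G \<noteq> {}" using valid by (auto simp: valid_network_def)
    show "1 - 1 / ?n powr c \<le> \<P>(w in coin_space G.
        indep (output_set ?A G w) (edges G) \<and> real (card (output_set ?A G w)) \<ge> ?a)"
    proof (cases "2 \<le> card (nodes G)")
      case True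
      let ?K = "nodes G \<times> {..<T * block_length (size_bound G)}"
      let ?C = "\<lambda>S. real (card (chosen_nodes G (\<lambda>v i. (v, i) \<in> S) T))"
      have "\<P>(w in coin_space G. indep (output_set ?A G w) (edges G) \<and> real (card (output_set ?A G w)) \<ge> ?a)
          = \<P>(w in coin_space G. real (card (chosen_nodes G w T)) \<ge> ?a)"
        by (simp add: output_set_streak_algorithm[OF valid] indep_chosen_nodes[OF valid])
      also have "\<dots> = subset_mean (1/2) ?K (\<lambda>S. of_bool (?C S \<ge> ?a))"
        by (rule prob_coin_space_finite[OF fin(1)]) (metis chosen_nodes_cong)
      finally have prob: "\<P>(w in coin_space G. indep (output_set ?A G w) (edges G) \<and>
          real (card (output_set ?A G w)) \<ge> ?a) = subset_mean (1/2) ?K (\<lambda>S. of_bool (?C S \<ge> ?a))" .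
      have "subset_mean (1/2) ?K (\<lambda>S. of_bool (?C S \<ge> ?a)) + subset_mean (1/2) ?K (\<lambda>S. of_bool (?C S < ?a))
          = subset_mean (1/2) ?K (\<lambda>_. 1)"
        unfolding subset_mean_add[symmetric] by (rule subset_mean_cong) auto
      also have "\<dots> = 1" using fin by simp
      finally show ?thesis
        using prob chosen_nodes_fail[OF valid True D _ _ assms, of \<epsilon> T] \<epsilon> T(1) by (simp add: K_def)
    next
      case False
      \<comment> \<open>For one node the required probability is
        \<open>1 - 1 / 1 = 0\<close>.\<close>
      then have "card (nodes G) = 1" using fin by (cases "card (nodes G)") auto
      then show ?thesis by simp
    qed
  qed
qed

end
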